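(* Let $n\ge2$, $-1\le d_0\le d_\infty<\frac1{n-1}$, $\kappa_i,\theta_i,k_i>0$ ($i=1,\dots,n$), and let $\alpha>0$, $L>0$ be arbitrary. Consider the noise-free error system $$\dot e_i=-k_i\phi_i(e_1)+e_{i+1}\ (i=1,\dots,n-1),\qquad \dot e_n=-k_n\phi_n(e_1)+\delta(t),$$ and the scaled error system obtained from it by the replacement $$\kappa_i\to\Big(\frac{L^n}{\alpha}\Big)^{\frac{d_0}{r_{0,i}}}\kappa_i,\qquad \theta_i\to\Big(\frac{L^n}{\alpha}\Big)^{\frac{d_\infty}{r_{\infty,i}}}\theta_i,\qquad k_i\to L^ik_i .$$ Then the linear state transformation $e_i\to\frac{L^{n-i+1}}{\alpha}e_i$ together with the time scaling $t\to Lt$ transforms the scaled error system into the original error system; consequently, under the scaling, settling times are divided by $L$ (for corresponding initial conditions) and the Lipschitz constant is multiplied by $\alpha$: $T\to\frac1LT$, $\Delta\to\alpha\Delta$. In particular, an arbitrary pair of worst-case convergence time and Lipschitz constant can be assigned: suppose $d_0<0<d_\infty$ and the gains are such that, for every $\delta$ with $|\delta(t)|\le\Delta$, all solutions of the original error system vanish for all $t\ge\bar T$, where $\bar T>0$ is independent of the initial condition (here $\Delta>0$ if $d_0=-1$, and $\Delta=0$ if $d_0>-1$). Let $\bar T^*>0$ and let $\Delta^*>0$ if $d_0=-1$, $\Delta^*=0$ if $d_0>-1$. If $L\ge\bar T/\bar T^*$ and, in case $d_0=-1$, $\alpha\ge\Delta^*/\Delta$ (with $\alpha>0$ arbitrary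 if $d_0>-1$), then for every $\delta$ with $|\delta(t)|\le\Delta^*$ all solutions of the scaled error system vanish for all $t\ge\bar T^*$, for every initial condition.
   Context: For real $z,p$: $\lceil z\rfloor^{p}=|z|^p\,\mathrm{sign}(z)$. For $i=1,\dots,n+1$: $r_{0,i}=1-(n-i)d_0$, $r_{\infty,i}=1-(n-i)d_\infty$. For $i=1,\dots,n$: $$\varphi_i(s)=\kappa_i\lceil s\rfloor^{\frac{r_{0,i+1}}{r_{0,i}}}+\theta_i\lceil s\rfloor^{\frac{r_{\infty,i+1}}{r_{\infty,i}}},\qquad \phi_i=\varphi_i\circ\cdots\circ\varphi_1 .$$ If $d_0=-1$, solutions are in the sense of Filippov, with $\lceil0\rfloor^0=[-1,1]$. The error system is that of the differentiator $\dot x_i=-k_i\phi_i(x_1-f_0)+x_{i+1}$ ($i<n$), $\dot x_n=-k_n\phi_n(x_1-f_0)$ for a noise-free $n$-times differentiable signal $f_0$, with $e_i=x_i-f_0^{(i-1)}$ and $\delta=-f_0^{(n)}$. The Lipschitz constant $\Delta$ is the bound $|f_0^{(n)}(t)|\le\Delta$ under which exact convergence is guaranteed. The settling time $T$ at an initial condition is the smallest time after which all solutions from it remain at $0$. *)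

theory Defs
  imports "HOL-Analysis.Analysis"
begin

section \<open>Absolutely continuous curves and Filippov solutions\<close>

definition abs_continuous_on :: "real \<Rightarrow> real \<Rightarrow> (real \<Rightarrow> 'a::real_normed_vector) \<Rightarrow> bool" where
  "abs_continuous_on a b f \<longleftrightarrow>
    (\<forall>\<epsilon>>0. \<exists>\<eta>>0. \<forall>D :: (real \<times> real) set.
       finite D \<and> (\<forall>(u, v)\<in>D. a \<le> u \<and> u \<le> v \<and> v \<le> b) \<and>
       disjoint_family_on (\<lambda>(u, v). {u<..<v}) D \<and> (\<Sum>(u, v)\<in>D. v - u) < \<eta>
       \<longrightarrow> (\<Sum>(u, v)\<in>D. norm (f v - f u)) < \<epsilon>)"

definition filippov :: "('a::euclidean_space \<Rightarrow> 'b::euclidean_space) \<Rightarrow> 'a \<Rightarrow> 'b set" where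
  "filippov f x =
    (\<Inter>\<epsilon>\<in>{0<..}. \<Inter>N\<in>null_sets lebesgue. closure (convex hull (f ` (ball x \<epsilon> - N))))"

text \<open>Admissible velocities at time \<open>t\<close> in state \<open>x\<close> for a vector field \<open>F\<close>: solutions are
  Filippov solutions if \<open>d0 = -1\<close>, and ordinary (Caratheodory) solutions otherwise.\<close>

definition velocities ::
    "real \<Rightarrow> (real \<Rightarrow> 'a::euclidean_space \<Rightarrow> 'a) \<Rightarrow> real \<Rightarrow> 'a \<Rightarrow> 'a set" where
  "velocities d0 F t x = (if d0 = -1 then filippov (F t) x else {F t x})"

text \<open>A solution lives on the interval \<open>[0, b)\<close>, where \<open>b = \<infinity>\<close> is allowed; the values of the
  function \<open>e\<close> outside that interval are irrelevant.\<close>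

definition solution ::
    "real \<Rightarrow> (real \<Rightarrow> 'a::euclidean_space \<Rightarrow> 'a) \<Rightarrow> ereal \<Rightarrow> (real \<Rightarrow> 'a) \<Rightarrow> bool" where
  "solution d0 F b e \<longleftrightarrow>
    0 < b \<and>
    (\<forall>s. 0 \<le> s \<and> ereal s < b \<longrightarrow> abs_continuous_on 0 s e) \<and>
    (AE t in lebesgue. 0 < t \<and> ereal t < b \<longrightarrow>
       (\<exists>v\<in>velocities d0 F t (e t). (e has_vector_derivative v) (at t)))"

definition maximal_solution ::
    "real \<Rightarrow> (real \<Rightarrow> 'a::euclidean_space \<Rightarrow> 'a) \<Rightarrow> ereal \<Rightarrow> (real \<Rightarrow> 'a) \<Rightarrow> bool" where
  "maximal_solution d0 F b e \<longleftrightarrow>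
    solution d0 F b e \<and>
    \<not> (\<exists>b' e'. b < b' \<and> solution d0 F b' e' \<and> (\<forall>t. 0 \<le> t \<and> ereal t < b \<longrightarrow> e' t = e t))"


section \<open>The error system\<close>

definition spow :: "real \<Rightarrow> real \<Rightarrow> real" where
  "spow z p = \<bar>z\<bar> powr p * sgn z"

text \<open>The value of \<open>spow 0 0\<close> never matters: exponent \<open>0\<close> occurs only for \<open>d0 = -1\<close>, and then the
  regularization replaces it by the whole interval from \<open>-1\<close> to \<open>1\<close>.\<close>

lemma filippov_spow_zero: "filippov (\<lambda>z. spow z 0) 0 = {-1..1}"
proof
  have "filippov (\<lambda>z. spow z 0) 0 \<subseteq> closure (convex hull ((\<lambda>z. spow z 0) ` (ball 0 1 - {})))"
    unfolding filippov_def by (rule INF_lower2[of 1], simp, rule INF_lower, simp)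
  also have "\<dots> \<subseteq> {-1..1}"
    by (intro closure_minimal hull_minimal) (auto simp: spow_def sgn_if)
  finally show "filippov (\<lambda>z. spow z 0) 0 \<subseteq> {-1..1}" .
next
  show "{-1..1} \<subseteq> filippov (\<lambda>z. spow z 0) 0"
    unfolding filippov_def
  proof (intro INF_greatest)
    fix \<epsilon> :: real and N :: "real set"
    assume "\<epsilon> \<in> {0<..}" and N: "N \<in> null_sets lebesgue"
    then have \<epsilon>: "\<epsilon> > 0" by simp
    let ?S = "(\<lambda>z. spow z 0) ` (ball 0 \<epsilon> - N)"
    have *: "\<not> {a<..<b} \<subseteq> N" if "a < b" for a b
      using that N negligible_subset[of N "{a<..<b}"] open_not_negligible[of "{a<..<b}"]
      by (auto simp: negligible_iff_null_sets)
    obtain y where "0 < y" "y < \<epsilon>" "y \<notin> N" using *[OF \<epsilon>] by (meson greaterThanLessThan_iff subsetI)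
    then have 1: "1 \<in> ?S"
      by (intro image_eqI[of _ _ y]) (auto simp: spow_def)
    obtain z where "-\<epsilon> < z" "z < 0" "z \<notin> N" using *[of "-\<epsilon>" 0] \<epsilon> by (metis greaterThanLessThan_iff neg_less_0_iff_less subsetI)
    then have 2: "-1 \<in> ?S"
      by (intro image_eqI[of _ _ z]) (auto simp: spow_def)
    have "{-1..1} = convex hull {-1, 1::real}"
      by (simp add: segment_convex_hull[symmetric] closed_segment_eq_real_ivl)
    also have "\<dots> \<subseteq> convex hull ?S" using 1 2 by (intro hull_mono) auto
    also have "\<dots> \<subseteq> closure (convex hull ?S)" by (rule closure_subset)
    finally show "{-1..1} \<subseteq> closure (convex hull ?S)" .
  qed
qed

definition weight :: "nat \<Rightarrow> real \<Rightarrow> nat \<Rightarrow> real" where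
  "weight n d i = 1 - (real n - real i) * d"

definition varphi ::
    "nat \<Rightarrow> real \<Rightarrow> real \<Rightarrow> (nat \<Rightarrow> real) \<Rightarrow> (nat \<Rightarrow> real) \<Rightarrow> nat \<Rightarrow> real \<Rightarrow> real" where
  "varphi n d0 dinf \<kappa> \<theta> i s =
     \<kappa> i * spow s (weight n d0 (i + 1) / weight n d0 i) +
     \<theta> i * spow s (weight n dinf (i + 1) / weight n dinf i)"

primrec phi ::
    "nat \<Rightarrow> real \<Rightarrow> real \<Rightarrow> (nat \<Rightarrow> real) \<Rightarrow> (nat \<Rightarrow> real) \<Rightarrow> nat \<Rightarrow> real \<Rightarrow> real" where
  "phi n d0 dinf \<kappa> \<theta> 0 = id"
| "phi n d0 dinf \<kappa> \<theta> (Suc i) = varphi n d0 dinf \<kappa> \<theta> (Suc i) \<circ> phi n d0 dinf \<kappa> \<theta> i"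

text \<open>The state space is \<open>real ^ 'n\<close> for a linearly ordered finite index type \<open>'n\<close>; the order
  numbers the coordinates by \<open>1, \<dots>, CARD('n)\<close>.\<close>

definition position :: "'n::{finite, linorder} \<Rightarrow> nat" where
  "position j = card {..j}"

definition coord :: "real ^ 'n::{finite, linorder} \<Rightarrow> nat \<Rightarrow> real" where
  "coord x i = x $ inv position i"

lemma bij_betw_position:
  "bij_betw (position :: 'n::{finite, linorder} \<Rightarrow> nat) UNIV {1..CARD('n)}"
proof -
  have "position i < position j" if "i < j" for i j :: 'n
    unfolding position_def using that by (intro psubset_card_mono) (auto simp: not_le)
  then have inj: "inj (position :: 'n \<Rightarrow> nat)"
    by (metis injI linorder_neqE less_irrefl)
  have "position j \<in> {1..CARD('n)}" for j :: 'n
    unfolding position_def by (auto simp: Suc_le_eq card_gt_0_iff intro: card_mono)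
  then have "range (position :: 'n \<Rightarrow> nat) = {1..CARD('n)}"
    by (intro card_subset_eq) (auto simp: card_image[OF inj])
  with inj show ?thesis by (simp add: bij_betw_def)
qed

definition error_system ::
    "nat \<Rightarrow> real \<Rightarrow> real \<Rightarrow> (nat \<Rightarrow> real) \<Rightarrow> (nat \<Rightarrow> real) \<Rightarrow> (nat \<Rightarrow> real) \<Rightarrow>
     (real \<Rightarrow> real) \<Rightarrow> real \<Rightarrow> real ^ 'n::{finite, linorder} \<Rightarrow> real ^ 'n::{finite, linorder}" where
  "error_system n d0 dinf \<kappa> \<theta> k \<delta> t e =
     (\<chi> j. let i = position j in
        - k i * phi n d0 dinf \<kappa> \<theta> i (coord e 1) +
        (if i < n then coord e (i + 1) else \<delta> t))"


section \<open>Scaling\<close>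

definition scaled_inner_gain ::
    "nat \<Rightarrow> real \<Rightarrow> real \<Rightarrow> real \<Rightarrow> (nat \<Rightarrow> real) \<Rightarrow> nat \<Rightarrow> real" where
  "scaled_inner_gain n L \<alpha> d \<gamma> i = (L ^ n / \<alpha>) powr (d / weight n d i) * \<gamma> i"

definition scaled_outer_gain :: "real \<Rightarrow> (nat \<Rightarrow> real) \<Rightarrow> nat \<Rightarrow> real" where
  "scaled_outer_gain L k i = L ^ i * k i"

definition scaled_error_system ::
    "real \<Rightarrow> real \<Rightarrow> nat \<Rightarrow> real \<Rightarrow> real \<Rightarrow> (nat \<Rightarrow> real) \<Rightarrow> (nat \<Rightarrow> real) \<Rightarrow> (nat \<Rightarrow> real) \<Rightarrow>
     (real \<Rightarrow> real) \<Rightarrow> real \<Rightarrow> real ^ 'n::{finite, linorder} \<Rightarrow> real ^ 'n::{finite, linorder}" where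
  "scaled_error_system L \<alpha> n d0 dinf \<kappa> \<theta> k =
     error_system n d0 dinf (scaled_inner_gain n L \<alpha> d0 \<kappa>) (scaled_inner_gain n L \<alpha> dinf \<theta>)
       (scaled_outer_gain L k)"

definition state_scaling ::
    "nat \<Rightarrow> real \<Rightarrow> real \<Rightarrow> real ^ 'n::{finite, linorder} \<Rightarrow> real ^ 'n::{finite, linorder}" where
  "state_scaling n L \<alpha> e = (\<chi> j. L ^ (n + 1 - position j) / \<alpha> * e $ j)"


section \<open>Settling times and Lipschitz constants\<close>

definition disturbances :: "real \<Rightarrow> (real \<Rightarrow> real) set" where
  "disturbances \<Delta> = {\<delta> \<in> borel_measurable (lebesgue_on {0..}). \<forall>t\<ge>0. \<bar>\<delta> t\<bar> \<le> \<Delta>}"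

text \<open>In the following, \<open>S\<close> maps a disturbance to the corresponding time-varying vector field.
  Saying that all solutions vanish from time \<open>T\<close> on includes that none of them escapes in
  finite time.\<close>

definition settles_by ::
    "real \<Rightarrow> ((real \<Rightarrow> real) \<Rightarrow> real \<Rightarrow> 'a::euclidean_space \<Rightarrow> 'a) \<Rightarrow> (real \<Rightarrow> real) set \<Rightarrow> 'a \<Rightarrow>
     real \<Rightarrow> bool" where
  "settles_by d0 S D x T \<longleftrightarrow>
    (\<forall>\<delta>\<in>D. \<forall>b e. maximal_solution d0 (S \<delta>) b e \<and> e 0 = x \<longrightarrow> b = \<infinity> \<and> (\<forall>t\<ge>T. e t = 0))"

definition is_settling_time ::
    "real \<Rightarrow> ((real \<Rightarrow> real) \<Rightarrow> real \<Rightarrow> 'a::euclidean_space \<Rightarrow> 'a) \<Rightarrow> (real \<Rightarrow> real) set \<Rightarrow> 'a \<Rightarrow>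
     real \<Rightarrow> bool" where
  "is_settling_time d0 S D x T \<longleftrightarrow>
    0 \<le> T \<and> settles_by d0 S D x T \<and> (\<forall>T'\<ge>0. settles_by d0 S D x T' \<longrightarrow> T \<le> T')"

text \<open>Exact convergence under the bound \<open>\<Delta>\<close> on the disturbance, in finite time and
  asymptotically, respectively.\<close>

definition finite_time_exact ::
    "real \<Rightarrow> ((real \<Rightarrow> real) \<Rightarrow> real \<Rightarrow> 'a::euclidean_space \<Rightarrow> 'a) \<Rightarrow> real \<Rightarrow> bool" where
  "finite_time_exact d0 S \<Delta> \<longleftrightarrow>
    (\<forall>\<delta>\<in>disturbances \<Delta>. \<forall>b e. maximal_solution d0 (S \<delta>) b e \<longrightarrow>
       b = \<infinity> \<and> (\<exists>T\<ge>0. \<forall>t\<ge>T. e t = 0))"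

definition asymptotically_exact ::
    "real \<Rightarrow> ((real \<Rightarrow> real) \<Rightarrow> real \<Rightarrow> 'a::euclidean_space \<Rightarrow> 'a) \<Rightarrow> real \<Rightarrow> bool" where
  "asymptotically_exact d0 S \<Delta> \<longleftrightarrow>
    (\<forall>\<delta>\<in>disturbances \<Delta>. \<forall>b e. maximal_solution d0 (S \<delta>) b e \<longrightarrow>
       b = \<infinity> \<and> (e \<longlongrightarrow> 0) at_top)"

end

theory Submission
  imports Defs
begin

text \<open>Each inner gain is scaled so that \<open>varphi i\<close> is replaced by its conjugate under multiplication with
  \<open>L^n / \<alpha>\<close>; hence so are the compositions, and the two vector fields are conjugate under the state
  transformation, up to the factor \<open>L\<close>. Everything else is invariance under such a conjugation.
  It suffices to transport solutions in one direction, since the inverse of the conjugation is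
  again one.\<close>

section \<open>Conjugate differential inclusions\<close>

lemma closure_convex_hull_linear_image_subset:
  fixes A :: "'a::euclidean_space \<Rightarrow> 'b::euclidean_space"
  assumes "linear A"
  shows "A ` closure (convex hull X) \<subseteq> closure (convex hull (A ` X))"
  using closure_linear_image_subset[OF assms, of "convex hull X"]
  by (simp add: convex_hull_linear_image[OF assms])

lemma negligible_linear_image:
  fixes A :: "'a::euclidean_space \<Rightarrow> 'b::euclidean_space"
  assumes "linear A" "negligible N" "DIM('a) \<le> DIM('b)"
  shows "negligible (A ` N)"
  using assms linear_imp_differentiable_on[OF assms(1)]
  by (intro negligible_differentiable_image_negligible)

text \<open>States and velocities get separate maps \<open>T\<close> and \<open>A\<close>, because a
  change of time scale also rescales velocities. Continuity of \<open>T\<close> provides a ball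
  around \<open>x\<close> that is mapped into the given ball around \<open>T x\<close>, and the
  removed null set is pulled back along \<open>inv T\<close>, which is linear and hence preserves
  null sets. So each set in the intersection for \<open>G\<close> contains the
  \<open>A\<close>-image of one in the intersection for \<open>H\<close>.\<close>

lemma filippov_linear_image:
  fixes T :: "'a::euclidean_space \<Rightarrow> 'a" and A :: "'b::euclidean_space \<Rightarrow> 'c::euclidean_space"
  assumes T: "linear T" "bij T" and A: "linear A"
    and conj: "\<And>y. G (T y) = A (H y)"
    and v: "v \<in> filippov H x"
  shows "A v \<in> filippov G (T x)"
  unfolding filippov_def
proof (intro INT_I)
  fix \<epsilon> :: real and N :: "'a set"
  assume \<epsilon>: "\<epsilon> \<in> {0<..}" and N: "N \<in> null_sets lebesgue"
  have "linear (inv T)"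
    using T by (metis bij_is_inj bij_is_surj inj_linear_imp_inv_linear)
  then have "negligible (inv T ` N)"
    using N by (intro negligible_linear_image) (auto simp: negligible_iff_null_sets)
  then have N': "inv T ` N \<in> null_sets lebesgue"
    by (simp add: negligible_iff_null_sets)
  have "isCont T x"
    using T(1) by (simp add: linear_continuous_at linear_linear)
  then obtain \<eta> where \<eta>: "\<eta> > 0" "\<And>y. dist y x < \<eta> \<Longrightarrow> dist (T y) (T x) < \<epsilon>"
    using \<epsilon> unfolding continuous_at_eps_delta by auto
  have "v \<in> closure (convex hull (H ` (ball x \<eta> - inv T ` N)))"
    using v \<eta>(1) N' unfolding filippov_def by blast
  then have "A v \<in> closure (convex hull (A ` H ` (ball x \<eta> - inv T ` N)))"
    using closure_convex_hull_linear_image_subset[OF A] by blast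
  moreover have "A ` H ` (ball x \<eta> - inv T ` N) \<subseteq> G ` (ball (T x) \<epsilon> - N)"
  proof clarify
    fix y assume y: "y \<in> ball x \<eta>" "y \<notin> inv T ` N"
    have "T y \<notin> N"
      using y(2) T(2) by (metis bij_inv_eq_iff image_eqI)
    moreover have "T y \<in> ball (T x) \<epsilon>"
      using \<eta>(2)[of y] y(1) by (simp add: dist_commute)
    ultimately show "A (H y) \<in> G ` (ball (T x) \<epsilon> - N)"
      using conj[of y] by (metis DiffI image_eqI)
  qed
  ultimately show "A v \<in> closure (convex hull (G ` (ball (T x) \<epsilon> - N)))"
    using closure_mono[OF hull_mono] by blast
qed

section \<open>Solutions under a linear change of state and a change of time scale\<close>

lemma abs_continuous_on_time_state_scaling:
  fixes T :: "'a::euclidean_space \<Rightarrow> 'b::real_normed_vector"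
  assumes T: "linear T" and L: "L > 0" and f: "abs_continuous_on (a / L) (b / L) f"
  shows "abs_continuous_on a b (\<lambda>\<tau>. T (f (\<tau> / L)))"
  unfolding abs_continuous_on_def
proof (intro allI impI)
  fix \<epsilon> :: real assume \<epsilon>: "\<epsilon> > 0"
  \<comment> \<open>Increments of the curve are stretched by at most \<open>B\<close>, so the
    tolerance handed to \<open>f\<close> is \<open>\<epsilon> / B\<close>.\<close>
  obtain B where B: "B > 0" "\<And>x. norm (T x) \<le> B * norm x"
    using linear_bounded_pos[OF T] by blast
  have \<epsilon>B: "\<epsilon> / B > 0" using \<epsilon> B(1) by simp
  obtain \<eta> where \<eta>: "\<eta> > 0" and "\<forall>D :: (real \<times> real) set.
       finite D \<and> (\<forall>(u, v)\<in>D. a / L \<le> u \<and> u \<le> v \<and> v \<le> b / L) \<and>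
       disjoint_family_on (\<lambda>(u, v). {u<..<v}) D \<and> (\<Sum>(u, v)\<in>D. v - u) < \<eta>
       \<longrightarrow> (\<Sum>(u, v)\<in>D. norm (f v - f u)) < \<epsilon> / B"
    using f[unfolded abs_continuous_on_def, rule_format, OF \<epsilon>B] by blast
  then have \<eta>': "(\<Sum>(u, v)\<in>D. norm (f v - f u)) < \<epsilon> / B"
    if "finite D" "\<forall>(u, v)\<in>D. a / L \<le> u \<and> u \<le> v \<and> v \<le> b / L"
       "disjoint_family_on (\<lambda>(u, v). {u<..<v}) D" "(\<Sum>(u, v)\<in>D. v - u) < \<eta>" for D
    using that by blast
  show "\<exists>\<eta>>0. \<forall>D :: (real \<times> real) set.
       finite D \<and> (\<forall>(u, v)\<in>D. a \<le> u \<and> u \<le> v \<and> v \<le> b) \<and>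
       disjoint_family_on (\<lambda>(u, v). {u<..<v}) D \<and> (\<Sum>(u, v)\<in>D. v - u) < \<eta>
       \<longrightarrow> (\<Sum>(u, v)\<in>D. norm (T (f (v / L)) - T (f (u / L)))) < \<epsilon>"
  \<comment> \<open>Dividing all end points by \<open>L\<close> divides the total length by
    \<open>L\<close>, so the threshold \<open>\<eta>\<close> for \<open>f\<close> becomes
    \<open>L * \<eta>\<close>.\<close>
  proof (intro exI[of _ "L * \<eta>"] conjI allI impI; (elim conjE)?)
    show "L * \<eta> > 0" using L \<eta> by simp
    fix D :: "(real \<times> real) set"
    assume D: "finite D" "\<forall>(u, v)\<in>D. a \<le> u \<and> u \<le> v \<and> v \<le> b"
      "disjoint_family_on (\<lambda>(u, v). {u<..<v}) D" "(\<Sum>(u, v)\<in>D. v - u) < L * \<eta>"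
    define h where "h = (\<lambda>(u, v). (u / L, v / L) :: real \<times> real)"
    have inj: "inj_on h D"
      using L by (auto simp: h_def inj_on_def)
    have "(\<Sum>(u, v)\<in>h ` D. norm (f v - f u)) < \<epsilon> / B"
    proof (rule \<eta>')
      show "finite (h ` D)" using D(1) by simp
      show "\<forall>(u, v)\<in>h ` D. a / L \<le> u \<and> u \<le> v \<and> v \<le> b / L"
        using D(2) L by (fastforce simp: h_def intro: divide_right_mono)
      show "disjoint_family_on (\<lambda>(u, v). {u<..<v}) (h ` D)"
        unfolding disjoint_family_on_def
      proof (intro ballI impI)
        fix p q assume "p \<in> h ` D" "q \<in> h ` D" "p \<noteq> q"
        then obtain u v u' v' where uv: "(u, v) \<in> D" "(u', v') \<in> D" "(u, v) \<noteq> (u', v')"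
          "p = (u / L, v / L)" "q = (u' / L, v' / L)"
          by (auto simp: h_def)
        have "{u<..<v} \<inter> {u'<..<v'} = {}"
          using disjoint_family_onD[OF D(3) uv(1,2,3)] by simp
        \<comment> \<open>A point \<open>z\<close> lies in a rescaled interval exactly if
          \<open>L * z\<close> lies in the original one, so disjointness carries over.\<close>
        then have "L * z \<notin> {u<..<v} \<inter> {u'<..<v'}" for z
          by simp
        then show "(case p of (u, v) \<Rightarrow> {u<..<v}) \<inter> (case q of (u, v) \<Rightarrow> {u<..<v}) = {}"
          using L by (fastforce simp: uv(4,5) field_simps)
      qed
      have "(\<Sum>(u, v)\<in>h ` D. v - u) = (\<Sum>(u, v)\<in>D. v - u) / L"
        unfolding sum.reindex[OF inj] sum_divide_distrib
        by (intro sum.cong) (auto simp: h_def diff_divide_distrib)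
      then show "(\<Sum>(u, v)\<in>h ` D. v - u) < \<eta>"
        using D(4) L by (simp add: divide_less_eq mult.commute)
    qed
    then have less: "(\<Sum>(u, v)\<in>D. norm (f (v / L) - f (u / L))) < \<epsilon> / B"
      unfolding sum.reindex[OF inj] by (simp add: h_def case_prod_unfold)
    have "(\<Sum>(u, v)\<in>D. norm (T (f (v / L)) - T (f (u / L))))
        \<le> (\<Sum>(u, v)\<in>D. B * norm (f (v / L) - f (u / L)))"
      using B(2) by (intro sum_mono) (auto simp: linear_diff[OF T, symmetric])
    also have "\<dots> = B * (\<Sum>(u, v)\<in>D. norm (f (v / L) - f (u / L)))"
      by (simp add: sum_distrib_left case_prod_unfold)
    also have "\<dots> < \<epsilon>"
      using less B(1) by (simp add: less_divide_eq mult.commute)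
    finally show "(\<Sum>(u, v)\<in>D. norm (T (f (v / L)) - T (f (u / L)))) < \<epsilon>" .
  qed
qed

text \<open>The new exceptional times lie in the image of a null set under multiplication by
  \<open>L\<close>, a linear map, and so form a null set again.\<close>

lemma AE_lebesgue_divide:
  fixes L :: real
  assumes P: "AE t in lebesgue. P t" and L: "L \<noteq> 0"
  shows "AE t in lebesgue. P (t / L)"
proof -
  obtain N where N: "N \<in> null_sets lebesgue" "{t. \<not> P t} \<subseteq> N"
    using P by (auto simp: eventually_ae_filter)
  have "negligible ((\<lambda>t. L * t) ` N)"
    using N(1) by (intro negligible_linear_image)
      (auto simp: negligible_iff_null_sets linear_times)
  moreover have "{t. \<not> P (t / L)} \<subseteq> (\<lambda>t. L * t) ` N"
    using N(2) L by (auto intro!: image_eqI[where x = "_ / L"])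
  ultimately show ?thesis
    by (intro AE_I') (auto simp: negligible_iff_null_sets)
qed

lemma ereal_less_scale_iff:
  fixes L s :: real
  assumes "L > 0"
  shows "ereal s < ereal L * b \<longleftrightarrow> ereal (s / L) < b"
  using assms by (cases b) (auto simp: field_simps)

text \<open>The assumption \<open>conj\<close> matches the chain rule: where \<open>e\<close> has
  derivative \<open>v\<close>, the new curve has derivative \<open>(1 / L) *\<^sub>R T v\<close>. In
  the Filippov case this map on velocities is the \<open>A\<close> of
  \<open>filippov_linear_image\<close>.\<close>

lemma solution_transform:
  fixes F G :: "real \<Rightarrow> 'a::euclidean_space \<Rightarrow> 'a"
  assumes T: "linear T" "bij T" and L: "L > 0"
    and conj: "\<And>\<tau> x. (1 / L) *\<^sub>R T (G (\<tau> / L) x) = F \<tau> (T x)"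
    and sol: "solution d0 G b e"
  shows "solution d0 F (ereal L * b) (\<lambda>\<tau>. T (e (\<tau> / L)))"
  unfolding solution_def
proof (intro conjI allI impI; (elim conjE)?)
  show "0 < ereal L * b"
    using sol ereal_less_scale_iff[OF L, of 0 b] by (simp add: solution_def zero_ereal_def)
next
  fix s assume "0 \<le> s" "ereal s < ereal L * b"
  then have "abs_continuous_on 0 (s / L) e"
    using sol L by (simp add: solution_def ereal_less_scale_iff)
  then show "abs_continuous_on 0 s (\<lambda>\<tau>. T (e (\<tau> / L)))"
    using abs_continuous_on_time_state_scaling[OF T(1) L, of 0 s e] by simp
next
  have "AE t in lebesgue. 0 < t / L \<and> ereal (t / L) < b \<longrightarrow>
       (\<exists>v\<in>velocities d0 G (t / L) (e (t / L)). (e has_vector_derivative v) (at (t / L)))"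
    using sol L by (intro AE_lebesgue_divide) (auto simp: solution_def)
  then show "AE \<tau> in lebesgue. 0 < \<tau> \<and> ereal \<tau> < ereal L * b \<longrightarrow>
    (\<exists>v\<in>velocities d0 F \<tau> (T (e (\<tau> / L))).
       ((\<lambda>\<tau>. T (e (\<tau> / L))) has_vector_derivative v) (at \<tau>))"
  proof (rule AE_mp, intro AE_I2 impI)
    fix \<tau>
    assume *: "0 < \<tau> / L \<and> ereal (\<tau> / L) < b \<longrightarrow>
       (\<exists>v\<in>velocities d0 G (\<tau> / L) (e (\<tau> / L)). (e has_vector_derivative v) (at (\<tau> / L)))"
      and "0 < \<tau> \<and> ereal \<tau> < ereal L * b"
    then obtain v where v: "v \<in> velocities d0 G (\<tau> / L) (e (\<tau> / L))"
      "(e has_vector_derivative v) (at (\<tau> / L))"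
      using L by (auto simp: ereal_less_scale_iff)
    have "(1 / L) *\<^sub>R T v \<in> velocities d0 F \<tau> (T (e (\<tau> / L)))"
    proof (cases "d0 = -1")
      case True
      then have "v \<in> filippov (G (\<tau> / L)) (e (\<tau> / L))"
        using v(1) by (simp add: velocities_def)
      moreover have "linear (\<lambda>v. (1 / L) *\<^sub>R T v)"
        using T(1) by (rule linear_compose_scale_right)
      ultimately show ?thesis
        using filippov_linear_image[OF T, of "\<lambda>v. (1 / L) *\<^sub>R T v" "F \<tau>" "G (\<tau> / L)"]
        by (simp add: velocities_def True conj)
    next
      case False
      with v(1) show ?thesis by (simp add: velocities_def conj)
    qed
    moreover have "((\<lambda>\<tau>. T (e (\<tau> / L))) has_vector_derivative (1 / L) *\<^sub>R T v) (at \<tau>)"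
    proof -
      have "((\<lambda>\<tau>. \<tau> / L) has_vector_derivative 1 / L) (at \<tau>)"
        by (auto intro!: derivative_eq_intros)
      from vector_diff_chain_at[OF this v(2)]
      have "((\<lambda>\<tau>. e (\<tau> / L)) has_vector_derivative (1 / L) *\<^sub>R v) (at \<tau>)"
        by (simp add: o_def)
      then have "((\<lambda>\<tau>. T (e (\<tau> / L))) has_vector_derivative T ((1 / L) *\<^sub>R v)) (at \<tau>)"
        by (rule bounded_linear.has_vector_derivative[OF T(1)[unfolded linear_conv_bounded_linear]])
      then show ?thesis by (simp only: linear_cmul[OF T(1)])
    qed
    ultimately show "\<exists>v\<in>velocities d0 F \<tau> (T (e (\<tau> / L))).
       ((\<lambda>\<tau>. T (e (\<tau> / L))) has_vector_derivative v) (at \<tau>)" by blast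
  qed
qed

section \<open>Transport of curves as an equivalence between conjugate systems\<close>

locale time_state_scaling =
  fixes L :: real and T :: "'a::euclidean_space \<Rightarrow> 'a"
  assumes linear: "linear T" and bij: "bij T" and pos: "L > 0"
begin

text \<open>Time \<open>t\<close> corresponds to \<open>L * t\<close>, so a curve with life span
  \<open>b\<close> is transported to one with life span \<open>ereal L * b\<close>.\<close>

definition transport :: "(real \<Rightarrow> 'a) \<Rightarrow> real \<Rightarrow> 'a" where
  "transport e \<tau> = T (e (\<tau> / L))"

lemma linear_inv: "linear (inv T)"
  using linear bij by (metis bij_is_inj bij_is_surj inj_linear_imp_inv_linear)

lemma eq_0_iff: "T x = 0 \<longleftrightarrow> x = 0"
  using linear bij by (metis bij_is_inj injD linear_0)

lemma surj_transport: "\<exists>e. e' = transport e"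
proof
  show "e' = transport (\<lambda>t. inv T (e' (L * t)))"
    using pos bij by (auto simp: transport_def fun_eq_iff bij_is_surj surj_f_inv_f)
qed

lemma surj_ereal_scale: "\<exists>b. b' = ereal L * b"
  using pos by (intro exI[of _ "ereal (1 / L) * b'"])
    (simp flip: mult.assoc add: one_ereal_def[symmetric])

lemma ereal_scale_less_iff: "ereal L * b < ereal L * b' \<longleftrightarrow> b < b'"
  using pos by (cases b; cases b') auto

lemma ereal_scale_eq_infinity_iff: "ereal L * b = \<infinity> \<longleftrightarrow> b = \<infinity>"
  using pos by (cases b) auto

text \<open>Transport is surjective on curves, and multiplication by \<open>L\<close> is surjective
  on life spans. Quantifiers over all solutions of one system can thus be re-indexed by those of the
  other, which reduces the equivalences below to rewriting under the quantifiers.\<close>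

lemma all_transport_iff:
  "(\<forall>b e. P b e) \<longleftrightarrow> (\<forall>b e. P (ereal L * b) (transport e))"
  using surj_transport surj_ereal_scale by metis

lemma ex_transport_iff:
  "(\<exists>b e. P b e) \<longleftrightarrow> (\<exists>b e. P (ereal L * b) (transport e))"
  using all_transport_iff[of "\<lambda>b e. \<not> P b e"] by blast

lemma all_time_iff: "(\<forall>\<tau>. P \<tau>) \<longleftrightarrow> (\<forall>t. P (L * t))" for P :: "real \<Rightarrow> bool"
proof
  assume *: "\<forall>t. P (L * t)"
  show "\<forall>\<tau>. P \<tau>" using *[rule_format, of "_ / L"] pos by simp
qed simp

lemma transport_scale: "transport e (L * t) = T (e t)"
  using pos by (simp add: transport_def)

lemma transport_eq_iff: "transport e (L * t) = transport e' (L * t) \<longleftrightarrow> e t = e' t"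
  using bij by (simp add: transport_scale bij_is_inj inj_eq)

lemma transport_0_eq_iff: "transport e 0 = T x \<longleftrightarrow> e 0 = x"
  using bij by (simp add: transport_def bij_is_inj inj_eq)

lemma transport_vanishes_iff:
  "(\<forall>\<tau>\<ge>L * s. transport e \<tau> = 0) \<longleftrightarrow> (\<forall>t\<ge>s. e t = 0)"
  unfolding all_time_iff[of "\<lambda>\<tau>. L * s \<le> \<tau> \<longrightarrow> transport e \<tau> = 0"]
  using pos by (simp add: transport_scale eq_0_iff)

lemma transport_eventually_vanishes_iff:
  "(\<exists>s\<ge>0. \<forall>\<tau>\<ge>s. transport e \<tau> = 0) \<longleftrightarrow> (\<exists>s\<ge>0. \<forall>t\<ge>s. e t = 0)"
proof -
  \<comment> \<open>The existential form of \<open>all_time_iff\<close> comes from applying it to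
    the negated predicate.\<close>
  have "(\<exists>s\<ge>0. \<forall>\<tau>\<ge>s. transport e \<tau> = 0) \<longleftrightarrow> (\<exists>s. L * s \<ge> 0 \<and> (\<forall>\<tau>\<ge>L * s. transport e \<tau> = 0))"
    using all_time_iff[of "\<lambda>s. \<not> (s \<ge> 0 \<and> (\<forall>\<tau>\<ge>s. transport e \<tau> = 0))"] by blast
  then show ?thesis
    using pos by (simp add: transport_vanishes_iff zero_le_mult_iff)
qed

lemma transport_tendsto_0_iff: "(transport e \<longlongrightarrow> 0) at_top \<longleftrightarrow> (e \<longlongrightarrow> 0) at_top"
proof
  assume *: "(transport e \<longlongrightarrow> 0) at_top"
  have "filterlim (\<lambda>t. L * t) at_top at_top"
    using pos by (intro filterlim_tendsto_pos_mult_at_top[OF tendsto_const]) (auto simp: filterlim_ident)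
  then have "((\<lambda>t. transport e (L * t)) \<longlongrightarrow> 0) at_top"
    by (rule filterlim_compose[OF *])
  then have "((\<lambda>t. inv T (transport e (L * t))) \<longlongrightarrow> inv T 0) at_top"
    by (rule linear_continuous_at[OF linear_inv[unfolded linear_conv_bounded_linear],
          THEN isCont_tendsto_compose])
  then show "(e \<longlongrightarrow> 0) at_top"
    using bij linear_inv by (simp add: transport_scale bij_is_inj linear_0)
next
  assume *: "(e \<longlongrightarrow> 0) at_top"
  have "filterlim (\<lambda>\<tau>. \<tau> * (1 / L)) at_top at_top"
    using pos by (intro filterlim_at_top_mult_tendsto_pos[OF tendsto_const]) (auto simp: filterlim_ident)
  then have "((\<lambda>\<tau>. e (\<tau> / L)) \<longlongrightarrow> 0) at_top"
    using filterlim_compose[OF *] by simp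
  then have "((\<lambda>\<tau>. T (e (\<tau> / L))) \<longlongrightarrow> T 0) at_top"
    by (rule linear_continuous_at[OF linear[unfolded linear_conv_bounded_linear],
          THEN isCont_tendsto_compose])
  then show "(transport e \<longlongrightarrow> 0) at_top"
    using linear by (simp add: transport_def[abs_def] linear_0)
qed

lemma solution_transport_iff:
  assumes conj: "\<And>\<tau> x. (1 / L) *\<^sub>R T (G (\<tau> / L) x) = F \<tau> (T x)"
  shows "solution d0 F (ereal L * b) (transport e) \<longleftrightarrow> solution d0 G b e"
proof
  assume "solution d0 G b e"
  then show "solution d0 F (ereal L * b) (transport e)"
    unfolding transport_def[abs_def] by (rule solution_transform[where F = F and G = G, OF linear bij pos conj])
next
  \<comment> \<open>This is \<open>conj\<close> solved for \<open>G\<close>. It has the same shape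
    with \<open>inv T\<close> and \<open>1 / L\<close> in place of \<open>T\<close> and
    \<open>L\<close>, so \<open>solution_transform\<close> also carries solutions back.\<close>
  have "(1 / (1 / L)) *\<^sub>R inv T (F (t / (1 / L)) x) = G t (inv T x)" for t x
  proof -
    have "F (t * L) x = (1 / L) *\<^sub>R T (G t (inv T x))"
      using conj[of "t * L" "inv T x"] pos bij by (simp add: bij_is_surj surj_f_inv_f)
    then show ?thesis
      using pos bij by (simp add: linear_cmul[OF linear_inv] bij_is_inj)
  qed
  moreover assume "solution d0 F (ereal L * b) (transport e)"
  ultimately have "solution d0 G (ereal (1 / L) * (ereal L * b))
      (\<lambda>t. inv T (transport e (t / (1 / L))))"
    using pos bij by (intro solution_transform[where G = F] linear_inv bij_imp_bij_inv) auto
  moreover have "ereal (1 / L) * (ereal L * b) = b"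
    using pos by (simp flip: mult.assoc add: one_ereal_def[symmetric])
  moreover have "(\<lambda>t. inv T (transport e (t / (1 / L)))) = e"
    using pos bij by (auto simp: transport_def bij_is_inj)
  ultimately show "solution d0 G b e" by simp
qed

text \<open>Every candidate extension of a transported curve is itself a transport, and by
  injectivity of \<open>T\<close> it agrees with that curve before \<open>ereal L * b\<close>
  exactly if the original curves agree before \<open>b\<close>.\<close>

lemma maximal_solution_transport_iff:
  assumes conj: "\<And>\<tau> x. (1 / L) *\<^sub>R T (G (\<tau> / L) x) = F \<tau> (T x)"
  shows "maximal_solution d0 F (ereal L * b) (transport e) \<longleftrightarrow> maximal_solution d0 G b e"
proof -
  have agree: "(\<forall>\<tau>. 0 \<le> \<tau> \<and> ereal \<tau> < ereal L * b \<longrightarrow> transport e' \<tau> = transport e \<tau>) \<longleftrightarrow>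
      (\<forall>t. 0 \<le> t \<and> ereal t < b \<longrightarrow> e' t = e t)" for e'
    unfolding all_time_iff[of "\<lambda>\<tau>. 0 \<le> \<tau> \<and> ereal \<tau> < ereal L * b \<longrightarrow> transport e' \<tau> = transport e \<tau>"]
    using pos by (simp add: transport_eq_iff ereal_less_scale_iff zero_le_mult_iff del: times_ereal.simps)
  show ?thesis
    unfolding maximal_solution_def
      ex_transport_iff[of "\<lambda>b' e'. ereal L * b < b' \<and> solution d0 F b' e' \<and>
        (\<forall>\<tau>. 0 \<le> \<tau> \<and> ereal \<tau> < ereal L * b \<longrightarrow> e' \<tau> = transport e \<tau>)"]
    by (simp only: agree ereal_scale_less_iff solution_transport_iff[of G F, OF conj])
qed

section \<open>Settling and convergence when disturbances are transformed along\<close>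

context
  fixes F G :: "(real \<Rightarrow> real) \<Rightarrow> real \<Rightarrow> 'a \<Rightarrow> 'a" and m :: "(real \<Rightarrow> real) \<Rightarrow> real \<Rightarrow> real"
  assumes conj: "\<And>\<delta> \<tau> x. (1 / L) *\<^sub>R T (G \<delta> (\<tau> / L) x) = F (m \<delta>) \<tau> (T x)"
begin

text \<open>The set \<open>D\<close> is arbitrary, so that the result serves both a single
  disturbance and all disturbances under a bound.\<close>

lemma settles_by_transport_iff:
  "settles_by d0 F (m ` D) (T x) s \<longleftrightarrow> settles_by d0 G D x (s / L)"
proof -
  have vanishes: "(\<forall>\<tau>\<ge>s. transport e \<tau> = 0) \<longleftrightarrow> (\<forall>t\<ge>s / L. e t = 0)" for e
    using transport_vanishes_iff[of "s / L" e] pos by simp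
  have "(\<forall>b e. maximal_solution d0 (F (m \<delta>)) b e \<and> e 0 = T x \<longrightarrow> b = \<infinity> \<and> (\<forall>t\<ge>s. e t = 0)) \<longleftrightarrow>
    (\<forall>b e. maximal_solution d0 (G \<delta>) b e \<and> e 0 = x \<longrightarrow> b = \<infinity> \<and> (\<forall>t\<ge>s / L. e t = 0))" for \<delta>
    unfolding all_transport_iff[of "\<lambda>b e. maximal_solution d0 (F (m \<delta>)) b e \<and> e 0 = T x \<longrightarrow>
        b = \<infinity> \<and> (\<forall>t\<ge>s. e t = 0)"]
    by (simp only: vanishes maximal_solution_transport_iff[of "G \<delta>" "F (m \<delta>)", OF conj]
        ereal_scale_eq_infinity_iff transport_0_eq_iff)
  then show ?thesis by (simp add: settles_by_def)
qed

text \<open>Minimality is preserved because the competing times can be re-indexed as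
  \<open>L * t\<close>, which respects sign and order.\<close>

lemma is_settling_time_transport_iff:
  "is_settling_time d0 F (m ` D) (T x) s \<longleftrightarrow> is_settling_time d0 G D x (s / L)"
proof -
  have "0 \<le> s \<longleftrightarrow> 0 \<le> s / L" "0 \<le> L * t \<longleftrightarrow> 0 \<le> t" "L * t / L = t" "s \<le> L * t \<longleftrightarrow> s / L \<le> t" for t
    using pos by (auto simp: zero_le_divide_iff zero_le_mult_iff divide_le_eq mult.commute)
  then show ?thesis
    unfolding is_settling_time_def settles_by_transport_iff
      all_time_iff[of "\<lambda>s'. 0 \<le> s' \<longrightarrow> settles_by d0 G D x (s' / L) \<longrightarrow> s \<le> s'"]
    by (simp only:)
qed

lemma finite_time_exact_transport_iff:
  assumes "disturbances \<Delta> = m ` disturbances \<Delta>'"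
  shows "finite_time_exact d0 F \<Delta> \<longleftrightarrow> finite_time_exact d0 G \<Delta>'"
proof -
  have "(\<forall>b e. maximal_solution d0 (F (m \<delta>)) b e \<longrightarrow> b = \<infinity> \<and> (\<exists>s\<ge>0. \<forall>t\<ge>s. e t = 0)) \<longleftrightarrow>
    (\<forall>b e. maximal_solution d0 (G \<delta>) b e \<longrightarrow> b = \<infinity> \<and> (\<exists>s\<ge>0. \<forall>t\<ge>s. e t = 0))" for \<delta>
    unfolding all_transport_iff[of "\<lambda>b e. maximal_solution d0 (F (m \<delta>)) b e \<longrightarrow>
        b = \<infinity> \<and> (\<exists>s\<ge>0. \<forall>t\<ge>s. e t = 0)"]
    by (simp only: maximal_solution_transport_iff[of "G \<delta>" "F (m \<delta>)", OF conj]
        ereal_scale_eq_infinity_iff transport_eventually_vanishes_iff)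
  then show ?thesis by (simp add: finite_time_exact_def assms)
qed

lemma asymptotically_exact_transport_iff:
  assumes "disturbances \<Delta> = m ` disturbances \<Delta>'"
  shows "asymptotically_exact d0 F \<Delta> \<longleftrightarrow> asymptotically_exact d0 G \<Delta>'"
proof -
  have "(\<forall>b e. maximal_solution d0 (F (m \<delta>)) b e \<longrightarrow> b = \<infinity> \<and> (e \<longlongrightarrow> 0) at_top) \<longleftrightarrow>
    (\<forall>b e. maximal_solution d0 (G \<delta>) b e \<longrightarrow> b = \<infinity> \<and> (e \<longlongrightarrow> 0) at_top)" for \<delta>
    unfolding all_transport_iff[of "\<lambda>b e. maximal_solution d0 (F (m \<delta>)) b e \<longrightarrow>
        b = \<infinity> \<and> (e \<longlongrightarrow> 0) at_top"]
    by (simp only: maximal_solution_transport_iff[of "G \<delta>" "F (m \<delta>)", OF conj]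
        ereal_scale_eq_infinity_iff transport_tendsto_0_iff)
  then show ?thesis by (simp add: asymptotically_exact_def assms)
qed

end

end

text \<open>This handles the final claim, where the required time and disturbance bound are met only
  up to inequalities.\<close>

lemma settles_by_mono:
  assumes "settles_by d0 F D x s" "D' \<subseteq> D" "s \<le> s'"
  shows "settles_by d0 F D' x s'"
  using assms unfolding settles_by_def by (meson order_trans subsetD)


section \<open>Scaling of the error system\<close>

lemma disturbances_mono: "\<Delta> \<le> \<Delta>' \<Longrightarrow> disturbances \<Delta> \<subseteq> disturbances \<Delta>'"
  unfolding disturbances_def by force

lemma disturbances_scaling:
  assumes "\<delta> \<in> disturbances \<Delta>" "L > 0"
  shows "(\<lambda>\<tau>. c * \<delta> (\<tau> / L)) \<in> disturbances (\<bar>c\<bar> * \<Delta>)"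
proof -
  \<comment> \<open>Disturbances are only Lebesgue measurable, so the dilation must be measurable
    with Lebesgue sets on both sides, and it must preserve the half-line.\<close>
  have "(\<lambda>\<tau> :: real. (1 / L) *\<^sub>R \<tau>) \<in> lebesgue_on {0..} \<rightarrow>\<^sub>M lebesgue_on {0..}"
    using assms(2) by (intro measurable_restrict_space3 lebesgue_measurable_scaling) auto
  then have "(\<lambda>\<tau>. \<delta> ((1 / L) *\<^sub>R \<tau>)) \<in> borel_measurable (lebesgue_on {0..})"
    by (rule measurable_compose) (use assms(1) in \<open>simp add: disturbances_def\<close>)
  then have "(\<lambda>\<tau>. \<delta> (\<tau> / L)) \<in> borel_measurable (lebesgue_on {0..})"
    by simp
  then show ?thesis
    using assms by (auto simp: disturbances_def abs_mult intro!: mult_left_mono)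
qed

lemma disturbances_scaling_image:
  assumes "\<alpha> > 0" "L > 0"
  shows "disturbances \<Delta> = (\<lambda>\<delta> \<tau>. \<delta> (\<tau> / L) / \<alpha>) ` disturbances (\<alpha> * \<Delta>)"
proof (intro equalityI subsetI)
  fix \<delta> assume "\<delta> \<in> disturbances \<Delta>"
  \<comment> \<open>The preimage is \<open>\<alpha> * \<delta> (L * t)\<close>, written as a
    division by \<open>1 / L\<close> so that \<open>disturbances_scaling\<close> applies to the
    inverse scaling as well.\<close>
  then have "(\<lambda>t. \<alpha> * \<delta> (t / (1 / L))) \<in> disturbances (\<alpha> * \<Delta>)"
    using disturbances_scaling[of \<delta> \<Delta> "1 / L" \<alpha>] assms by simp
  then show "\<delta> \<in> (\<lambda>\<delta> \<tau>. \<delta> (\<tau> / L) / \<alpha>) ` disturbances (\<alpha> * \<Delta>)"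
    using assms by (intro image_eqI) auto
next
  fix \<delta> assume "\<delta> \<in> (\<lambda>\<delta> \<tau>. \<delta> (\<tau> / L) / \<alpha>) ` disturbances (\<alpha> * \<Delta>)"
  then show "\<delta> \<in> disturbances \<Delta>"
    using disturbances_scaling[of _ "\<alpha> * \<Delta>" L "1 / \<alpha>"] assms by auto
qed

section \<open>Homogeneity weights and the functions \<open>phi\<close>\<close>

lemma weight_pos:
  assumes "d < 1 / (real n - 1)" "n \<ge> 2" "i \<in> {1..n}"
  shows "weight n d i > 0"
proof (cases "d \<le> 0")
  case True
  then have "(real n - real i) * d \<le> 0"
    using assms by (simp add: mult_nonneg_nonpos)
  then show ?thesis by (simp add: weight_def)
next
  case False
  \<comment> \<open>For positive \<open>d\<close> the weight is smallest at \<open>i = 1\<close>,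
    where its positivity is exactly the upper bound on \<open>d\<close>.\<close>
  then have "(real n - real i) * d \<le> (real n - 1) * d"
    using assms by (intro mult_right_mono) auto
  also have "\<dots> < 1"
    using assms by (simp add: field_simps)
  finally show ?thesis by (simp add: weight_def)
qed

text \<open>Consecutive weights differ by \<open>d\<close>, so the exponent is
  \<open>1 + d / weight n d i\<close>. Pulling the factor \<open>L ^ n / \<alpha>\<close> out of
  \<open>spow\<close> therefore yields the factor itself, which the division cancels, times the
  power contained in the scaled gain.\<close>

lemma scaled_inner_gain_spow:
  assumes "L ^ n / \<alpha> > 0" "weight n d i \<noteq> 0"
  shows "scaled_inner_gain n L \<alpha> d \<gamma> i * spow s (weight n d (i + 1) / weight n d i) =
    \<gamma> i * spow (L ^ n / \<alpha> * s) (weight n d (i + 1) / weight n d i) / (L ^ n / \<alpha>)"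
proof -
  define M where "M = L ^ n / \<alpha>"
  have M: "M > 0" using assms(1) by (simp add: M_def)
  have "weight n d (i + 1) / weight n d i = 1 + d / weight n d i"
    using assms(2) by (simp add: weight_def field_simps)
  then have "spow (M * s) (weight n d (i + 1) / weight n d i) =
      M * M powr (d / weight n d i) * spow s (weight n d (i + 1) / weight n d i)"
    using M by (simp add: spow_def abs_mult powr_mult powr_add sgn_mult)
  then show ?thesis
    using M by (simp add: scaled_inner_gain_def flip: M_def)
qed

text \<open>Each \<open>varphi\<close> is conjugated by multiplication with
  \<open>L ^ n / \<alpha>\<close>, and a composition of conjugates is the conjugate of the
  composition.\<close>

lemma phi_scaled:
  assumes "L ^ n / \<alpha> > 0" "\<And>j. j \<in> {1..i} \<Longrightarrow> weight n d0 j \<noteq> 0 \<and> weight n dinf j \<noteq> 0"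
  shows "phi n d0 dinf (scaled_inner_gain n L \<alpha> d0 \<kappa>) (scaled_inner_gain n L \<alpha> dinf \<theta>) i s =
    phi n d0 dinf \<kappa> \<theta> i (L ^ n / \<alpha> * s) / (L ^ n / \<alpha>)"
  using assms(2)
proof (induction i)
  have M: "L ^ n / \<alpha> \<noteq> 0" using assms(1) by linarith
  case 0
  show ?case by (simp only: phi.simps id_apply nonzero_mult_div_cancel_left[OF M])
next
  case (Suc i)
  have IH: "phi n d0 dinf (scaled_inner_gain n L \<alpha> d0 \<kappa>) (scaled_inner_gain n L \<alpha> dinf \<theta>) i s =
    phi n d0 dinf \<kappa> \<theta> i (L ^ n / \<alpha> * s) / (L ^ n / \<alpha>)"
    using Suc by simp
  have "weight n d0 (Suc i) \<noteq> 0" "weight n dinf (Suc i) \<noteq> 0"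
    using Suc.prems[of "Suc i"] by auto
  moreover have "L ^ n / \<alpha> \<noteq> 0" using assms(1) by linarith
  \<comment> \<open>The division left by the first \<open>i\<close> functions cancels against the
    factor inside the next one.\<close>
  then have "L ^ n / \<alpha> * (x / (L ^ n / \<alpha>)) = x" for x
    unfolding times_divide_eq_right by (rule nonzero_mult_div_cancel_left)
  ultimately show ?case
    using assms(1)
    by (simp only: phi.simps o_apply IH varphi_def scaled_inner_gain_spow add_divide_distrib not_False_eq_True)
qed

section \<open>Coordinates and the state transformation\<close>

lemma position_range: "position (j :: 'n::{finite, linorder}) \<in> {1..CARD('n)}"
  using bij_betw_position by (auto simp: bij_betw_def)

lemma position_inv:
  assumes "i \<in> {1..CARD('n)}"
  shows "position (inv position i :: 'n::{finite, linorder}) = i"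
  using assms bij_betw_position[where 'n = 'n] by (metis bij_betw_imp_surj_on f_inv_into_f)

lemma coord_state_scaling:
  fixes x :: "real ^ 'n::{finite, linorder}"
  assumes "i \<in> {1..CARD('n)}"
  shows "coord (state_scaling n L \<alpha> x) i = L ^ (n + 1 - i) / \<alpha> * coord x i"
  by (simp add: coord_def state_scaling_def position_inv[OF assms])

lemma linear_state_scaling: "linear (state_scaling n L \<alpha>)"
  by (rule linearI) (auto simp: state_scaling_def vec_eq_iff distrib_left)

lemma bij_state_scaling:
  assumes "L \<noteq> 0" "\<alpha> \<noteq> 0"
  shows "bij (state_scaling n L \<alpha> :: real ^ 'n::{finite, linorder} \<Rightarrow> real ^ 'n::{finite, linorder})"
proof (rule o_bij)
  let ?R = "\<lambda>x :: real ^ 'n::{finite, linorder}. (\<chi> j. \<alpha> / L ^ (n + 1 - position j) * x $ j)"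
  show "?R \<circ> state_scaling n L \<alpha> = id" "state_scaling n L \<alpha> \<circ> ?R = id"
    using assms by (auto simp: fun_eq_iff vec_eq_iff state_scaling_def)
qed

text \<open>Componentwise, three scalings have to match: the injection term through
  \<open>phi_scaled\<close> and the outer gains, the coupling to the next coordinate, and the
  disturbance in the last component.\<close>

lemma state_scaling_scaled_error_system:
  fixes x :: "real ^ 'n::{finite, linorder}"
  assumes n: "n = CARD('n)" and scaling: "\<alpha> > 0" "L > 0"
    and weight: "\<And>i. i \<in> {1..n} \<Longrightarrow> weight n d0 i \<noteq> 0 \<and> weight n dinf i \<noteq> 0"
  shows "(1 / L) *\<^sub>R state_scaling n L \<alpha> (scaled_error_system L \<alpha> n d0 dinf \<kappa> \<theta> k \<delta> (\<tau> / L) x) =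
    error_system n d0 dinf \<kappa> \<theta> k (\<lambda>\<tau>. \<delta> (\<tau> / L) / \<alpha>) \<tau> (state_scaling n L \<alpha> x)"
proof (subst vec_eq_iff, intro allI)
  fix j :: 'n
  define i where "i = position j"
  have i: "1 \<le> i" "i \<le> n" using position_range[of j] by (auto simp: i_def n)
  \<comment> \<open>Writing \<open>n\<close> as a sum removes the truncated subtraction from the
    exponent \<open>n + 1 - i\<close>.\<close>
  then obtain p where p: "n = i + p" using le_Suc_ex by blast
  have M: "L ^ n / \<alpha> > 0" using scaling by simp
  \<comment> \<open>The first coordinate is scaled by precisely the factor that conjugates the
    functions \<open>phi\<close>.\<close>
  have x1: "coord (state_scaling n L \<alpha> x) 1 = L ^ n / \<alpha> * coord x 1"
    using i by (subst coord_state_scaling) (auto simp: n)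
  have "phi n d0 dinf (scaled_inner_gain n L \<alpha> d0 \<kappa>) (scaled_inner_gain n L \<alpha> dinf \<theta>) i (coord x 1)
      = phi n d0 dinf \<kappa> \<theta> i (L ^ n / \<alpha> * coord x 1) / (L ^ n / \<alpha>)"
    using i weight by (intro phi_scaled M) auto
  note phi = this[folded x1]
  \<comment> \<open>State factor, outer gain and conjugation leave one surplus power of
    \<open>L\<close>, which the time scaling removes.\<close>
  have "L ^ (n + 1 - i) / \<alpha> * (L ^ i * c / (L ^ n / \<alpha>)) / L = c" for c
    using scaling by (simp add: p power_add)
  note outer = this
  \<comment> \<open>The factors of neighbouring coordinates differ by one power of \<open>L\<close>,
    again removed by the time scaling. For \<open>i = n\<close> the state factor is
    \<open>L / \<alpha>\<close>, which leaves
    \<open>\<delta> (\<tau> / L) / \<alpha>\<close>.\<close>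
  have shifted: "L ^ (n + 1 - i) / \<alpha> * (if i < n then coord x (i + 1) else \<delta> (\<tau> / L)) / L =
      (if i < n then coord (state_scaling n L \<alpha> x) (i + 1) else \<delta> (\<tau> / L) / \<alpha>)"
  proof (cases "i < n")
    case True
    then have "i + 1 \<in> {1..CARD('n)}" using n by auto
    then show ?thesis
      using True scaling by (simp add: coord_state_scaling p)
  next
    case False
    then show ?thesis using i scaling by (simp add: p)
  qed
  show "((1 / L) *\<^sub>R state_scaling n L \<alpha> (scaled_error_system L \<alpha> n d0 dinf \<kappa> \<theta> k \<delta> (\<tau> / L) x)) $ j =
    error_system n d0 dinf \<kappa> \<theta> k (\<lambda>\<tau>. \<delta> (\<tau> / L) / \<alpha>) \<tau> (state_scaling n L \<alpha> x) $ j"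
    (is "?l = ?r")
  proof -
    let ?\<phi> = "phi n d0 dinf \<kappa> \<theta> i (coord (state_scaling n L \<alpha> x) 1)"
    have "scaled_error_system L \<alpha> n d0 dinf \<kappa> \<theta> k \<delta> (\<tau> / L) x $ j =
        - (L ^ i * k i) * (?\<phi> / (L ^ n / \<alpha>)) + (if i < n then coord x (i + 1) else \<delta> (\<tau> / L))"
      by (simp only: scaled_error_system_def error_system_def Let_def vec_lambda_beta
          scaled_outer_gain_def phi flip: i_def)
    moreover have "?l = L ^ (n + 1 - i) / \<alpha> *
        (scaled_error_system L \<alpha> n d0 dinf \<kappa> \<theta> k \<delta> (\<tau> / L) x $ j) / L"
      by (simp add: state_scaling_def flip: i_def)
    ultimately have "?l = L ^ (n + 1 - i) / \<alpha> * (L ^ i * (- k i * ?\<phi>) / (L ^ n / \<alpha>)) / L +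
        L ^ (n + 1 - i) / \<alpha> * (if i < n then coord x (i + 1) else \<delta> (\<tau> / L)) / L"
      by (simp only: distrib_left add_divide_distrib) simp
    also have "\<dots> = ?r"
      unfolding outer shifted by (simp add: error_system_def Let_def flip: i_def)
    finally show ?thesis .
  qed
qed

theorem mainTheorem3:
  fixes n :: nat and d0 dinf \<alpha> L :: real and \<kappa> \<theta> k :: "nat \<Rightarrow> real"
    and F F' :: "(real \<Rightarrow> real) \<Rightarrow> real \<Rightarrow> real ^ 'n::{finite, linorder} \<Rightarrow> real ^ 'n::{finite, linorder}"
    and S :: "real ^ 'n::{finite, linorder} \<Rightarrow> real ^ 'n::{finite, linorder}"
  defines "F \<equiv> error_system n d0 dinf \<kappa> \<theta> k"
    and "F' \<equiv> scaled_error_system L \<alpha> n d0 dinf \<kappa> \<theta> k"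
    and "S \<equiv> state_scaling n L \<alpha>"
  assumes n: "n = CARD('n)" "n \<ge> 2"
    and d: "-1 \<le> d0" "d0 \<le> dinf" "dinf < 1 / (real n - 1)"
    and gains: "\<And>i. i \<in> {1..n} \<Longrightarrow> \<kappa> i > 0 \<and> \<theta> i > 0 \<and> k i > 0"
    and scaling: "\<alpha> > 0" "L > 0"
  shows
    \<comment> \<open>the state transformation and time scaling map the scaled system to the original one\<close>
    "(linear S \<and> bij S) \<and>
     (\<forall>\<delta> \<tau> x. (1 / L) *\<^sub>R S (F' \<delta> (\<tau> / L) x) = F (\<lambda>\<tau>. \<delta> (\<tau> / L) / \<alpha>) \<tau> (S x)) \<and>
     (\<forall>\<delta> b e. solution d0 (F' \<delta>) b e \<longleftrightarrow>
        solution d0 (F (\<lambda>\<tau>. \<delta> (\<tau> / L) / \<alpha>)) (ereal L * b) (\<lambda>\<tau>. S (e (\<tau> / L)))) \<and>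
    \<comment> \<open>settling times are divided by L, for a single disturbance and for a disturbance bound\<close>
     (\<forall>\<delta> x T. is_settling_time d0 F {\<lambda>\<tau>. \<delta> (\<tau> / L) / \<alpha>} (S x) T \<longleftrightarrow>
        is_settling_time d0 F' {\<delta>} x (T / L)) \<and>
     (\<forall>\<Delta>\<ge>0. \<forall>x T. is_settling_time d0 F (disturbances \<Delta>) (S x) T \<longleftrightarrow>
        is_settling_time d0 F' (disturbances (\<alpha> * \<Delta>)) x (T / L)) \<and>
    \<comment> \<open>the Lipschitz constant is multiplied by \<alpha>\<close>
     (\<forall>\<Delta>\<ge>0. (finite_time_exact d0 F \<Delta> \<longleftrightarrow> finite_time_exact d0 F' (\<alpha> * \<Delta>)) \<and>
        (asymptotically_exact d0 F \<Delta> \<longleftrightarrow> asymptotically_exact d0 F' (\<alpha> * \<Delta>))) \<and>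
    \<comment> \<open>assignment of the worst-case convergence time and the Lipschitz constant\<close>
     (\<forall>Tbar Tstar \<Delta> \<Delta>star.
        d0 < 0 \<and> 0 < dinf \<and> Tbar > 0 \<and> Tstar > 0 \<and>
        (if d0 = -1 then \<Delta> > 0 \<and> \<Delta>star > 0 else \<Delta> = 0 \<and> \<Delta>star = 0) \<and>
        (\<forall>x. settles_by d0 F (disturbances \<Delta>) x Tbar) \<and>
        L \<ge> Tbar / Tstar \<and> (d0 = -1 \<longrightarrow> \<alpha> \<ge> \<Delta>star / \<Delta>)
        \<longrightarrow> (\<forall>x. settles_by d0 F' (disturbances \<Delta>star) x Tstar))"
proof -
  define m where "m = (\<lambda>(\<delta> :: real \<Rightarrow> real) \<tau>. \<delta> (\<tau> / L) / \<alpha>)"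
  have S: "linear S" "bij S"
    unfolding S_def using scaling by (simp_all add: linear_state_scaling bij_state_scaling)
  interpret time_state_scaling L S
    using S scaling(2) by (rule time_state_scaling.intro)
  have weight: "weight n d0 i \<noteq> 0 \<and> weight n dinf i \<noteq> 0" if "i \<in> {1..n}" for i
    using weight_pos[of d0 n i] weight_pos[of dinf n i] d n(2) that by simp
  have conj: "(1 / L) *\<^sub>R S (F' \<delta> (\<tau> / L) x) = F (m \<delta>) \<tau> (S x)" for \<delta> \<tau> x
    unfolding S_def F_def F'_def m_def
    by (rule state_scaling_scaled_error_system[OF n(1) scaling weight])
  have image: "disturbances \<Delta> = m ` disturbances (\<alpha> * \<Delta>)" for \<Delta>
    unfolding m_def by (rule disturbances_scaling_image[OF scaling])
  \<comment> \<open>A single disturbance is treated as a one-element set, so that the lemmas about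
    images under \<open>m\<close> cover it.\<close>
  have m_eq: "(\<lambda>\<tau>. \<delta> (\<tau> / L) / \<alpha>) = m \<delta>" and single: "{m \<delta>} = m ` {\<delta>}" for \<delta>
    by (simp_all add: m_def)
  have assign: "settles_by d0 F' (disturbances \<Delta>star) x Tstar"
    if "\<forall>x. settles_by d0 F (disturbances \<Delta>) x Tbar" "Tstar > 0" "L \<ge> Tbar / Tstar"
      and \<Delta>: "if d0 = -1 then \<Delta> > 0 \<and> \<Delta>star > 0 else \<Delta> = 0 \<and> \<Delta>star = 0"
        "d0 = -1 \<longrightarrow> \<alpha> \<ge> \<Delta>star / \<Delta>" for Tbar Tstar \<Delta> \<Delta>star x
  proof (rule settles_by_mono)
    show "settles_by d0 F' (disturbances (\<alpha> * \<Delta>)) x (Tbar / L)"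
      \<comment> \<open>The settling assumption holds for every initial condition of
        \<open>F\<close>, in particular for \<open>S x\<close>, which corresponds to the given
        \<open>x\<close> of \<open>F'\<close>.\<close>
      using that(1) settles_by_transport_iff[of F' F m, OF conj] image by metis
    show "disturbances \<Delta>star \<subseteq> disturbances (\<alpha> * \<Delta>)"
      \<comment> \<open>If \<open>d0 = -1\<close>, the bound on \<open>\<alpha>\<close> gives
        \<open>\<Delta>star \<le> \<alpha> * \<Delta>\<close>; otherwise both sides are
        zero.\<close>
      using \<Delta> by (intro disturbances_mono) (auto simp: divide_le_eq split: if_splits)
    show "Tbar / L \<le> Tstar"
      using that(2,3) scaling by (simp add: field_simps)
  qed
  show ?thesis
    unfolding m_eq transport_def[symmetric, abs_def]
  proof (intro conjI allI impI)
    show "linear S" "bij S" by (fact S)+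
    fix \<delta> \<tau> x
    show "(1 / L) *\<^sub>R S (F' \<delta> (\<tau> / L) x) = F (m \<delta>) \<tau> (S x)" by (rule conj)
  next
    fix \<delta> b e
    show "solution d0 (F' \<delta>) b e \<longleftrightarrow> solution d0 (F (m \<delta>)) (ereal L * b) (transport e)"
      by (rule solution_transport_iff[of "F' \<delta>" "F (m \<delta>)", OF conj, symmetric])
  next
    fix \<delta> x T
    show "is_settling_time d0 F {m \<delta>} (S x) T \<longleftrightarrow> is_settling_time d0 F' {\<delta>} x (T / L)"
      unfolding single by (rule is_settling_time_transport_iff[of F' F m, OF conj])
  next
    fix \<Delta> x T
    show "is_settling_time d0 F (disturbances \<Delta>) (S x) T \<longleftrightarrow>
        is_settling_time d0 F' (disturbances (\<alpha> * \<Delta>)) x (T / L)"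
      unfolding image[of \<Delta>] by (rule is_settling_time_transport_iff[of F' F m, OF conj])
  next
    fix \<Delta>
    show "finite_time_exact d0 F \<Delta> \<longleftrightarrow> finite_time_exact d0 F' (\<alpha> * \<Delta>)"
      by (rule finite_time_exact_transport_iff[of F' F m, OF conj image])
    show "asymptotically_exact d0 F \<Delta> \<longleftrightarrow> asymptotically_exact d0 F' (\<alpha> * \<Delta>)"
      by (rule asymptotically_exact_transport_iff[of F' F m, OF conj image])
  qed (use assign in blast)
qed

end
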